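(* There exist functions $f\in\mathcal{T}_H^O$ that are not univalent on the lens domain $L=D(-i;\sqrt2)\cap D(i;\sqrt2)$.
   Context: $\mathbb{D}=\{z\in\mathbb{C}:|z|<1\}$, and $D(z_0;r)$ is the open disk with center $z_0\in\mathbb{C}$ and radius $r>0$ (note $L\subset\mathbb{D}$). A (complex-valued) harmonic function $f$ on $\mathbb{D}$ can be written $f=h+\overline{g}$ with $h,g$ analytic on $\mathbb{D}$; let $\omega$ be the meromorphic function given by $g'=\omega h'$ (removable singularities removed). $f$ is sense-preserving at $z_0\in\mathbb{D}$ if $h'\not\equiv 0$ in some neighborhood of $z_0$ and $\omega$ is analytic at $z_0$ with $|\omega(z_0)|<1$ (so $h'(z_0)=0$ is allowed); $f$ is sense-preserving in $\mathbb{D}$ if it is so at every point of $\mathbb{D}$. The class $\mathcal{T}_H$ consists of all sense-preserving harmonic functions $f=h+\overline{g}$ on $\mathbb{D}$ such that $f(z)$ is real if and only if $z$ is real, $f(0)=0$, $|h'(0)|=1$, and $f(r)>0$ for $0<r<1$. $\mathcal{T}_H^O$ is the subclass of those $f\in\mathcal{T}_H$ with $g'(0)=0$. Univalent means injective. *)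

theory Defs
  imports "HOL-Complex_Analysis.Complex_Analysis"
begin

abbreviation unit_disk :: "complex set" where
  "unit_disk \<equiv> ball 0 1"

text \<open>The two real partial derivatives of a function of \<open>z = x + \<i>y\<close> are
  \<open>dir_deriv 1\<close> (in \<open>x\<close>) and \<open>dir_deriv \<i>\<close> (in \<open>y\<close>).\<close>

definition dir_deriv :: "complex \<Rightarrow> (complex \<Rightarrow> complex) \<Rightarrow> complex \<Rightarrow> complex" where
  "dir_deriv v f z = vector_derivative (\<lambda>t::real. f (z + of_real t * v)) (at 0)"

definition C1_on :: "(complex \<Rightarrow> complex) \<Rightarrow> complex set \<Rightarrow> bool" where
  "C1_on f S \<longleftrightarrow>
     (\<forall>z\<in>S. f differentiable (at z)) \<and>
     continuous_on S (dir_deriv 1 f) \<and> continuous_on S (dir_deriv \<i> f)"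

definition harmonic_on :: "(complex \<Rightarrow> complex) \<Rightarrow> complex set \<Rightarrow> bool" where
  "harmonic_on f S \<longleftrightarrow>
     open S \<and> C1_on f S \<and> C1_on (dir_deriv 1 f) S \<and> C1_on (dir_deriv \<i> f) S \<and>
     (\<forall>z\<in>S. dir_deriv 1 (dir_deriv 1 f) z + dir_deriv \<i> (dir_deriv \<i> f) z = 0)"

text \<open>The pair \<open>(h, g)\<close> is determined by \<open>f\<close> up to additive constants, so \<open>h'\<close> and \<open>g'\<close> depend
  on \<open>f\<close> only.\<close>

definition canonical_decomposition ::
    "(complex \<Rightarrow> complex) \<Rightarrow> (complex \<Rightarrow> complex) \<Rightarrow> (complex \<Rightarrow> complex) \<Rightarrow> bool" where
  "canonical_decomposition f h g \<longleftrightarrow>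
     h holomorphic_on unit_disk \<and> g holomorphic_on unit_disk \<and>
     (\<forall>z\<in>unit_disk. f z = h z + cnj (g z))"

text \<open>\<open>remove_sings\<close> fills in the removable singularities of \<open>g'/h'\<close>. At a pole it takes the
  value 0, but is then not analytic there.\<close>

definition second_dilatation ::
    "(complex \<Rightarrow> complex) \<Rightarrow> (complex \<Rightarrow> complex) \<Rightarrow> complex \<Rightarrow> complex" where
  "second_dilatation h g = remove_sings (\<lambda>z. deriv g z / deriv h z)"

definition sense_preserving_at :: "(complex \<Rightarrow> complex) \<Rightarrow> complex \<Rightarrow> bool" where
  "sense_preserving_at f z0 \<longleftrightarrow>
     (\<exists>h g. canonical_decomposition f h g \<and>
        \<not> (\<forall>\<^sub>F z in nhds z0. deriv h z = 0) \<and>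
        second_dilatation h g analytic_on {z0} \<and> cmod (second_dilatation h g z0) < 1)"

definition sense_preserving :: "(complex \<Rightarrow> complex) \<Rightarrow> bool" where
  "sense_preserving f \<longleftrightarrow> (\<forall>z0\<in>unit_disk. sense_preserving_at f z0)"

definition T_H :: "(complex \<Rightarrow> complex) set" where
  "T_H = {f. harmonic_on f unit_disk \<and> sense_preserving f \<and>
     (\<forall>z\<in>unit_disk. f z \<in> \<real> \<longleftrightarrow> z \<in> \<real>) \<and>
     f 0 = 0 \<and>
     (\<exists>h g. canonical_decomposition f h g \<and> cmod (deriv h 0) = 1) \<and>
     (\<forall>r::real. 0 < r \<and> r < 1 \<longrightarrow> f (of_real r) \<in> \<real> \<and> 0 < Re (f (of_real r)))}"

definition T_H_O :: "(complex \<Rightarrow> complex) set" where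
  "T_H_O = {f \<in> T_H. \<exists>h g. canonical_decomposition f h g \<and> deriv g 0 = 0}"

definition lens :: "complex set" where
  "lens = ball (- \<i>) (sqrt 2) \<inter> ball \<i> (sqrt 2)"

end

theory Submission
  imports Defs
begin

text \<open>The counterexample is a shear construction in the horizontal direction. If \<open>f = h + cnj g\<close>
  and \<open>g' = \<omega> h'\<close>, then \<open>f = Re F + \<i> Im \<phi>\<close> with \<open>\<phi> = h - g\<close> and \<open>F = h + g\<close>, and
  \<open>F' = p \<phi>'\<close> for the function \<open>p = (1 + \<omega>) / (1 - \<omega>)\<close>, which has positive real part. So
  the condition that \<open>f\<close> is real exactly on the real axis only concerns \<open>\<phi>\<close>: it says that the
  analytic function \<open>\<phi>\<close> is typically real. The dilatation \<open>\<omega>\<close>, with \<open>\<omega>(0) = 0\<close>, remains free.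

  Every typically real analytic function is univalent on the lens, but its image of the lens may
  fail to be convex in the horizontal direction, and then shearing can destroy injectivity. For
  \<open>\<phi> = (k(z) - k(-z)) / 2\<close>, where \<open>k(z) = z / (1 - z)\<^sup>2\<close>, the lens is mapped onto the
  plane minus the two slits \<open>{\<i> y. \<bar>y\<bar> \<ge> 1/4}\<close>, which correspond to the two boundary arcs of
  the lens. On the right-hand half of the upper arc \<open>d\<phi>\<close> is a positive multiple of
  \<open>\<i>\<close>, so \<open>Re F\<close> decreases from the value 0 at the tip of the slit as soon as \<open>Im p > 0\<close>
  there. The dilatation \<open>\<omega> = z\<^sup>2\<close> has this property and gives the closed form
  \<open>F = u + (8/3) u\<^sup>3\<close> with \<open>u = z / (1 - z\<^sup>2)\<close>.

  Hence \<open>Re F\<close> is negative at points of the lens in the right half-plane near that arc, while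
  it is positive on \<open>(0, 1)\<close>; so it vanishes at some \<open>z\<close> of the lens with \<open>Re z > 0\<close>
  (\<open>exists_lens_imaginary_value\<close>). The symmetry \<open>f(- cnj z) = - cnj (f z)\<close>
  (\<open>counterexample_uminus_cnj\<close>) then makes \<open>f\<close> agree at the two different points \<open>z\<close> and
  \<open>- cnj z\<close> of the lens.\<close>

section \<open>Harmonic functions from pairs of holomorphic functions\<close>

lemma
  assumes "open S" "h holomorphic_on S" "g holomorphic_on S"
    and f: "\<And>z. z \<in> S \<Longrightarrow> f z = h z + cnj (g z)" and z: "z \<in> S"
  shows has_derivative_holomorphic_plus_cnj:
      "(f has_derivative (\<lambda>v. deriv h z * v + cnj (deriv g z * v))) (at z)"
    and dir_deriv_holomorphic_plus_cnj:
      "dir_deriv v f z = v * deriv h z + cnj (v * deriv g z)"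
proof -
  have "(h has_derivative (*) (deriv h z)) (at z)" "(g has_derivative (*) (deriv g z)) (at z)"
    using assms holomorphic_derivI[of _ S z] by (auto simp: has_field_derivative_def)
  then have "((\<lambda>z. h z + cnj (g z)) has_derivative
      (\<lambda>v. deriv h z * v + cnj (deriv g z * v))) (at z)"
    by (intro derivative_intros) auto
  then show D: "(f has_derivative (\<lambda>v. deriv h z * v + cnj (deriv g z * v))) (at z)"
    by (rule has_derivative_transform_within_open[OF _ \<open>open S\<close> z]) (simp add: f)
  have "((\<lambda>t::real. z + of_real t * v) has_derivative (\<lambda>t. of_real t * v)) (at 0)"
    by (auto intro!: derivative_eq_intros)
  then have "((\<lambda>t::real. f (z + of_real t * v)) has_derivative
      (\<lambda>t. deriv h z * (of_real t * v) + cnj (deriv g z * (of_real t * v)))) (at 0)"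
    by (rule has_derivative_compose) (use D in simp)
  then have "((\<lambda>t::real. f (z + of_real t * v)) has_vector_derivative
      v * deriv h z + cnj (v * deriv g z)) (at 0)"
    by (simp add: has_vector_derivative_def scaleR_conv_of_real algebra_simps)
  then show "dir_deriv v f z = v * deriv h z + cnj (v * deriv g z)"
    unfolding dir_deriv_def by (rule vector_derivative_at)
qed

lemma C1_on_holomorphic_plus_cnj:
  assumes "open S" "h holomorphic_on S" "g holomorphic_on S"
    and "\<And>z. z \<in> S \<Longrightarrow> f z = h z + cnj (g z)"
  shows "C1_on f S"
proof -
  have "continuous_on S (deriv h)" "continuous_on S (deriv g)"
    using assms by (auto intro!: holomorphic_on_imp_continuous_on holomorphic_deriv)
  then have "continuous_on S (\<lambda>z. v * deriv h z + cnj (v * deriv g z))" for v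
    by (intro continuous_intros)
  then have "continuous_on S (dir_deriv v f)" for v
    using dir_deriv_holomorphic_plus_cnj[OF assms] by (subst continuous_on_cong[OF refl]) auto
  then show ?thesis
    unfolding C1_on_def differentiable_def
    using has_derivative_holomorphic_plus_cnj[OF assms] by blast
qed

text \<open>The partial derivative in direction \<open>v\<close> of \<open>h + cnj g\<close> is again of this form, with the
  holomorphic parts \<open>v h'\<close> and \<open>v g'\<close>. Both second partials are thus obtained by applying the
  same formula twice, and the Laplacian carries the factor \<open>1\<^sup>2 + \<i>\<^sup>2 = 0\<close>.\<close>

lemma harmonic_on_holomorphic_plus_cnj:
  assumes S: "open S" and hol: "h holomorphic_on S" "g holomorphic_on S"
  shows "harmonic_on (\<lambda>z. h z + cnj (g z)) S"
proof -
  let ?f = "\<lambda>z. h z + cnj (g z)"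
  have hol': "(\<lambda>z. v * deriv h z) holomorphic_on S" "(\<lambda>z. v * deriv g z) holomorphic_on S" for v
    using S hol by (auto intro!: holomorphic_intros)
  note dd = dir_deriv_holomorphic_plus_cnj[OF S hol refl]
  note dd2 = dir_deriv_holomorphic_plus_cnj[OF S hol' dd]
  have dm: "deriv (\<lambda>z. v * deriv k z) z = v * deriv (deriv k) z"
    if "z \<in> S" "k holomorphic_on S" for v k z
    by (rule deriv_cmult) (use that S holomorphic_deriv holomorphic_on_imp_differentiable_at in blast)
  have "dir_deriv 1 (dir_deriv 1 ?f) z + dir_deriv \<i> (dir_deriv \<i> ?f) z = 0" if "z \<in> S" for z
    using that dd2[of z 1 1] dd2[of z \<i> \<i>] hol
      dm[of z h 1] dm[of z g 1] dm[of z h \<i>] dm[of z g \<i>] by simp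
  then show ?thesis
    unfolding harmonic_on_def
    using S C1_on_holomorphic_plus_cnj[OF S hol refl] C1_on_holomorphic_plus_cnj[OF S hol' dd]
    by blast
qed

text \<open>Zeros of \<open>h'\<close> are isolated, so the quotient \<open>g' / h'\<close> agrees with \<open>\<omega>\<close> on a punctured
  neighbourhood of every point, and removing its singularities yields \<open>\<omega>\<close>.\<close>

lemma sense_preserving_if_dilatation:
  assumes dec: "canonical_decomposition f h g"
    and \<omega>: "\<omega> holomorphic_on unit_disk" "\<And>z. z \<in> unit_disk \<Longrightarrow> cmod (\<omega> z) < 1"
    and gw: "\<And>z. z \<in> unit_disk \<Longrightarrow> deriv g z = \<omega> z * deriv h z"
    and h0: "z1 \<in> unit_disk" "deriv h z1 \<noteq> 0"
  shows "sense_preserving f"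
  unfolding sense_preserving_def
proof
  fix z0 assume z0: "z0 \<in> unit_disk"
  have hol: "deriv h holomorphic_on unit_disk"
    using dec by (auto simp: canonical_decomposition_def intro!: holomorphic_deriv)
  have nz: "\<forall>\<^sub>F z in at z. deriv h z \<noteq> 0 \<and> z \<in> unit_disk" if "z \<in> unit_disk" for z
    using non_zero_neighbour_alt[OF hol _ _ that h0] by simp
  have sd: "second_dilatation h g z = \<omega> z" if z: "z \<in> unit_disk" for z
    unfolding second_dilatation_def
  proof (rule remove_sings_eqI)
    have "\<omega> \<midarrow>z\<rightarrow> \<omega> z"
      using \<omega>(1) z by (meson continuous_on_eq_continuous_at holomorphic_on_imp_continuous_on
        isCont_def open_ball)
    moreover have "\<forall>\<^sub>F x in at z. \<omega> x = deriv g x / deriv h x"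
      using nz[OF z] by eventually_elim (simp add: gw)
    ultimately show "(\<lambda>x. deriv g x / deriv h x) \<midarrow>z\<rightarrow> \<omega> z"
      by (rule Lim_transform_eventually)
  qed
  have "second_dilatation h g holomorphic_on unit_disk"
    using \<omega>(1) sd by (subst holomorphic_cong[OF refl]) auto
  then have "second_dilatation h g analytic_on {z0}"
    using z0 analytic_at by blast
  moreover have "\<not> (\<forall>\<^sub>F z in nhds z0. deriv h z = 0)"
  proof
    assume "\<forall>\<^sub>F z in nhds z0. deriv h z = 0"
    then have "\<forall>\<^sub>F z in at z0. deriv h z = 0"
      by (simp add: eventually_nhds_conv_at)
    with nz[OF z0] have "\<forall>\<^sub>F z in at z0. False"
      by eventually_elim simp
    then show False by simp
  qed
  ultimately show "sense_preserving_at f z0"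
    unfolding sense_preserving_at_def using dec sd[OF z0] \<omega>(2)[OF z0] by metis
qed

section \<open>The sheared function\<close>

definition odd_koebe :: "complex \<Rightarrow> complex" where
  "odd_koebe z = z / (1 - z\<^sup>2)"

text \<open>This is \<open>(k(z) - k(-z)) / 2\<close> for the Koebe function \<open>k(z) = z / (1 - z)\<^sup>2\<close>.\<close>

definition typ_real :: "complex \<Rightarrow> complex" where
  "typ_real z = z * (1 + z\<^sup>2) / (1 - z\<^sup>2)\<^sup>2"

text \<open>The primitive, vanishing at 0, of \<open>(1 + z\<^sup>2) / (1 - z\<^sup>2)\<close> times the derivative of
  \<open>typ_real\<close>.\<close>

definition shear :: "complex \<Rightarrow> complex" where
  "shear z = odd_koebe z + 8 / 3 * odd_koebe z ^ 3"

definition h_part :: "complex \<Rightarrow> complex" where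
  "h_part z = (shear z + typ_real z) / 2"

definition g_part :: "complex \<Rightarrow> complex" where
  "g_part z = (shear z - typ_real z) / 2"

definition counterexample :: "complex \<Rightarrow> complex" where
  "counterexample z = h_part z + cnj (g_part z)"

lemma Re_counterexample: "Re (counterexample z) = Re (shear z)"
  and Im_counterexample: "Im (counterexample z) = Im (typ_real z)"
  by (auto simp: counterexample_def h_part_def g_part_def field_simps)

section \<open>The typically real part\<close>

lemma unit_disk_neq:
  assumes "z \<in> unit_disk"
  shows "z \<noteq> 1" "z \<noteq> - 1" "1 - z\<^sup>2 \<noteq> 0"
proof -
  show "z \<noteq> 1" "z \<noteq> - 1" using assms by auto
  then show "1 - z\<^sup>2 \<noteq> 0"
    by (simp add: power2_eq_1_iff)
qed

lemma typ_real_eq_koebe: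
  assumes "z \<noteq> 1" "z \<noteq> - 1"
  shows "typ_real z = (z / (1 - z)\<^sup>2 - (- z) / (1 - (- z))\<^sup>2) / 2"
proof -
  have "1 + z \<noteq> 0" using assms by (simp add: add_eq_0_iff)
  moreover have "1 - z\<^sup>2 = (1 - z) * (1 + z)" by (simp add: power2_eq_square algebra_simps)
  ultimately show ?thesis
    using assms unfolding typ_real_def
    by (simp add: power_mult_distrib divide_simps) (simp add: power2_eq_square algebra_simps)
qed

lemma Im_koebe:
  "Im (z / (1 - z)\<^sup>2) = Im z * (1 - (cmod z)\<^sup>2) / cmod (1 - z) ^ 4"
proof -
  have "z / (1 - z)\<^sup>2 = z * cnj ((1 - z)\<^sup>2) / of_real (cmod (1 - z) ^ 4)"
    by (subst complex_div_cnj) (simp add: norm_power flip: power_mult)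
  moreover have "Im (z * cnj ((1 - z)\<^sup>2)) = Im z * (1 - (cmod z)\<^sup>2)"
    unfolding cmod_power2 by (simp add: power2_eq_square algebra_simps)
  ultimately show ?thesis
    by (simp only: Im_divide_of_real)
qed

text \<open>The imaginary parts of \<open>k(z)\<close> and \<open>- k(-z)\<close> both have the sign of \<open>Im z\<close>, hence so
  does their mean.\<close>

lemma Im_typ_real_eq_0_iff:
  assumes z: "z \<in> unit_disk"
  shows "Im (typ_real z) = 0 \<longleftrightarrow> Im z = 0"
proof -
  have "(cmod z)\<^sup>2 < 1" using z by (simp add: power_less_one_iff)
  moreover have "Im (typ_real z) = Im z * (1 - (cmod z)\<^sup>2) *
      ((1 / cmod (1 - z) ^ 4 + 1 / cmod (1 + z) ^ 4) / 2)"
  proof -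
    have "Im (typ_real z) = (Im (z / (1 - z)\<^sup>2) - Im ((- z) / (1 - (- z))\<^sup>2)) / 2"
      using unit_disk_neq[OF z] by (simp add: typ_real_eq_koebe)
    also have "\<dots> = Im z * (1 - (cmod z)\<^sup>2) *
        ((1 / cmod (1 - z) ^ 4 + 1 / cmod (1 + z) ^ 4) / 2)"
      unfolding Im_koebe by (simp add: ring_distribs add_divide_distrib diff_divide_distrib)
    finally show ?thesis .
  qed
  moreover have "1 / cmod (1 - z) ^ 4 + 1 / cmod (1 + z) ^ 4 > 0"
    using unit_disk_neq[OF z]
    by (intro add_pos_pos divide_pos_pos zero_less_power) (auto simp: add_eq_0_iff)
  ultimately show ?thesis by auto
qed

section \<open>Derivatives and dilatation\<close>

lemma deriv_odd_koebe:
  assumes "1 - z\<^sup>2 \<noteq> 0"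
  shows "(odd_koebe has_field_derivative (1 + z\<^sup>2) / (1 - z\<^sup>2)\<^sup>2) (at z)"
proof -
  have "((\<lambda>z. z / (1 - z\<^sup>2)) has_field_derivative (1 + z\<^sup>2) / (1 - z\<^sup>2)\<^sup>2) (at z)"
    by (rule derivative_eq_intros refl assms)+ (simp add: power2_eq_square)
  then show ?thesis by (simp add: odd_koebe_def[abs_def])
qed

lemma deriv_shear:
  assumes "1 - z\<^sup>2 \<noteq> 0"
  shows "(shear has_field_derivative
    (1 + z\<^sup>2) * (1 + 6 * z\<^sup>2 + z ^ 4) / (1 - z\<^sup>2) ^ 4) (at z)"
proof -
  have eq: "1 + 8 * (odd_koebe z)\<^sup>2 = (1 + 6 * z\<^sup>2 + z ^ 4) / (1 - z\<^sup>2)\<^sup>2"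
    using assms
    by (simp add: odd_koebe_def power_divide add_divide_eq_iff)
       (simp add: eval_nat_numeral algebra_simps)
  have "((\<lambda>z. odd_koebe z + 8 / 3 * odd_koebe z ^ 3) has_field_derivative
      (1 + z\<^sup>2) / (1 - z\<^sup>2)\<^sup>2 * (1 + 8 * (odd_koebe z)\<^sup>2)) (at z)"
    by (rule derivative_eq_intros refl deriv_odd_koebe assms)+
       (simp add: algebra_simps add_divide_distrib)
  then show ?thesis unfolding eq
    by (simp add: shear_def[abs_def] flip: power_add)
qed

lemma deriv_typ_real:
  assumes "1 - z\<^sup>2 \<noteq> 0"
  shows "(typ_real has_field_derivative (1 + 6 * z\<^sup>2 + z ^ 4) / (1 - z\<^sup>2) ^ 3) (at z)"
proof -
  \<comment> \<open>In terms of \<open>D\<close> and the product form \<open>tr\<close>, the quotient rule only involves powers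
    of \<open>D\<close>, and the numerators are polynomials of degree 2 in \<open>D\<close>.\<close>
  define D where "D = 1 - z\<^sup>2"
  have D: "D \<noteq> 0" "z\<^sup>2 = 1 - D" using assms by (simp_all add: D_def)
  have z4: "z ^ 4 = (1 - D)\<^sup>2" by (simp flip: D(2) power_mult)
  have tr: "typ_real = (\<lambda>z. odd_koebe z * (2 / (1 - z\<^sup>2) - 1))"
  proof
    fix z :: complex
    show "typ_real z = odd_koebe z * (2 / (1 - z\<^sup>2) - 1)"
      by (cases "1 - z\<^sup>2 = 0")
         (simp_all add: typ_real_def odd_koebe_def divide_simps power2_eq_square)
  qed
  have "(typ_real has_field_derivative (1 + z\<^sup>2) / (1 - z\<^sup>2)\<^sup>2 * (2 / (1 - z\<^sup>2) - 1)
      + (4 * z / (1 - z\<^sup>2)\<^sup>2) * odd_koebe z) (at z)"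
    unfolding tr
    by (rule derivative_eq_intros refl deriv_odd_koebe assms)+ (simp add: power2_eq_square)
  also have "(1 + z\<^sup>2) / (1 - z\<^sup>2)\<^sup>2 * (2 / (1 - z\<^sup>2) - 1)
      + (4 * z / (1 - z\<^sup>2)\<^sup>2) * odd_koebe z = ((1 + z\<^sup>2) * (2 - D) + 4 * z\<^sup>2) / D ^ 3"
    using D(1) by (simp add: odd_koebe_def flip: D_def) (simp add: field_simps eval_nat_numeral)
  also have "(1 + z\<^sup>2) * (2 - D) + 4 * z\<^sup>2 = 1 + 6 * z\<^sup>2 + z ^ 4"
    unfolding z4 D(2) by (simp add: power2_eq_square algebra_simps)
  finally show ?thesis by (simp add: D_def)
qed

text \<open>The factor \<open>z\<^sup>2\<close> between the two derivatives is the dilatation.\<close>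

lemma
  assumes z: "1 - z\<^sup>2 \<noteq> 0"
  shows deriv_h_part:
      "(h_part has_field_derivative (1 + 6 * z\<^sup>2 + z ^ 4) / (1 - z\<^sup>2) ^ 4) (at z)"
    and deriv_g_part:
      "(g_part has_field_derivative z\<^sup>2 * ((1 + 6 * z\<^sup>2 + z ^ 4) / (1 - z\<^sup>2) ^ 4)) (at z)"
proof -
  define P where "P = 1 + 6 * z\<^sup>2 + z ^ 4"
  define Q where "Q = P / (1 - z\<^sup>2) ^ 4"
  have "(1 + z\<^sup>2) * P / (1 - z\<^sup>2) ^ 4 = (1 + z\<^sup>2) * Q"
    by (simp add: Q_def)
  then have F: "(shear has_field_derivative (1 + z\<^sup>2) * Q) (at z)"
    using deriv_shear[OF z] by (simp add: P_def)
  have "P / (1 - z\<^sup>2) ^ 3 = (1 - z\<^sup>2) * Q"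
    using z by (simp add: Q_def eval_nat_numeral)
  then have \<phi>: "(typ_real has_field_derivative (1 - z\<^sup>2) * Q) (at z)"
    using deriv_typ_real[OF z] by (simp add: P_def)
  have "(h_part has_field_derivative Q) (at z)"
    unfolding h_part_def[abs_def]
    by (rule derivative_eq_intros refl F \<phi>)+ (simp_all add: algebra_simps)
  moreover have "(g_part has_field_derivative z\<^sup>2 * Q) (at z)"
    unfolding g_part_def[abs_def]
    by (rule derivative_eq_intros refl F \<phi>)+ (simp_all add: algebra_simps)
  ultimately show
    "(h_part has_field_derivative (1 + 6 * z\<^sup>2 + z ^ 4) / (1 - z\<^sup>2) ^ 4) (at z)"
    "(g_part has_field_derivative z\<^sup>2 * ((1 + 6 * z\<^sup>2 + z ^ 4) / (1 - z\<^sup>2) ^ 4)) (at z)"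
    by (simp_all add: Q_def P_def)
qed

section \<open>Membership in the class\<close>

lemma counterexample_in_T_H_O: "counterexample \<in> T_H_O"
proof -
  have hol: "h_part holomorphic_on unit_disk" "g_part holomorphic_on unit_disk"
    using deriv_h_part deriv_g_part unit_disk_neq(3)
    unfolding holomorphic_on_open[OF open_ball] by blast+
  then have dec: "canonical_decomposition counterexample h_part g_part"
    by (simp add: canonical_decomposition_def counterexample_def)
  have dh: "deriv h_part z = (1 + 6 * z\<^sup>2 + z ^ 4) / (1 - z\<^sup>2) ^ 4"
    and dg: "deriv g_part z = z\<^sup>2 * deriv h_part z" if "z \<in> unit_disk" for z
    using deriv_h_part[of z] deriv_g_part[of z] unit_disk_neq(3)[OF that]
    by (auto dest!: DERIV_imp_deriv)
  have "harmonic_on counterexample unit_disk"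
    using harmonic_on_holomorphic_plus_cnj[OF open_ball hol]
    by (simp add: counterexample_def[abs_def])
  moreover have "sense_preserving counterexample"
    by (rule sense_preserving_if_dilatation[OF dec, of "\<lambda>z. z\<^sup>2" 0])
       (auto simp: dh dg norm_power power_less_one_iff intro!: holomorphic_intros)
  moreover have real_iff: "\<forall>z\<in>unit_disk. counterexample z \<in> \<real> \<longleftrightarrow> z \<in> \<real>"
    by (auto simp: complex_is_Real_iff Im_counterexample Im_typ_real_eq_0_iff)
  moreover have "counterexample 0 = 0"
    by (simp add: counterexample_def h_part_def g_part_def shear_def typ_real_def odd_koebe_def)
  moreover have "0 < Re (counterexample (of_real r))" if "0 < r" "r < 1" for r
  proof -
    define u where "u = r / (1 - r\<^sup>2)"
    have "r\<^sup>2 < 1" using that by (simp add: power_less_one_iff)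
    then have "u > 0" using that by (simp add: u_def)
    then have "u + 8 / 3 * u ^ 3 > 0" by (intro add_pos_pos mult_pos_pos) auto
    moreover have "shear (of_real r) = of_real (u + 8 / 3 * u ^ 3)"
      by (simp add: shear_def odd_koebe_def u_def)
    ultimately show ?thesis by (simp only: Re_counterexample Re_complex_of_real)
  qed
  ultimately show ?thesis
    using dec dh[of 0] dg[of 0] unfolding T_H_O_def T_H_def by auto
qed

section \<open>Failure of injectivity on the lens\<close>

lemma counterexample_uminus_cnj:
  "counterexample (- cnj z) = - cnj (counterexample z)"
proof -
  have "typ_real (- cnj z) = - cnj (typ_real z)" "odd_koebe (- cnj z) = - cnj (odd_koebe z)"
    by (simp_all add: typ_real_def odd_koebe_def)
  then show ?thesis
    by (simp add: counterexample_def h_part_def g_part_def shear_def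
        add_divide_distrib diff_divide_distrib)
qed

lemma mem_lens_iff: "z \<in> lens \<longleftrightarrow> (cmod z)\<^sup>2 + 2 * \<bar>Im z\<bar> < 1"
proof -
  have "cmod w < sqrt 2 \<longleftrightarrow> (cmod w)\<^sup>2 < 2" for w
    using real_sqrt_less_iff[of "(cmod w)\<^sup>2" 2] by simp
  then have "z \<in> lens \<longleftrightarrow> (cmod (- \<i> - z))\<^sup>2 < 2 \<and> (cmod (\<i> - z))\<^sup>2 < 2"
    by (simp add: lens_def dist_norm)
  moreover have "(cmod (- \<i> - z))\<^sup>2 = (cmod z)\<^sup>2 + 2 * Im z + 1"
      "(cmod (\<i> - z))\<^sup>2 = (cmod z)\<^sup>2 - 2 * Im z + 1"
    unfolding cmod_power2 by (simp_all add: power2_eq_square algebra_simps)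
  ultimately show ?thesis by auto
qed

text \<open>Along the vertical segment from \<open>1/2\<close> to \<open>1/2 + 3\<i>/10\<close> the real part of \<open>shear\<close>
  changes sign. The lower end lies on the positive real axis; the upper end is close to the arc of
  the boundary of the lens that is mapped to a slit by \<open>typ_real\<close>, so \<open>shear\<close> has a negative
  real part there.\<close>

lemma exists_lens_imaginary_value:
  "\<exists>z\<in>lens. Re z \<noteq> 0 \<and> Re (counterexample z) = 0"
proof -
  define p where "p t = Complex (1 / 2) t" for t
  have lens: "p t \<in> lens" if "0 \<le> t" "t \<le> 3 / 10" for t
  proof -
    have "t\<^sup>2 \<le> (3 / 10)\<^sup>2" using that by (intro power_mono) auto
    then show ?thesis using that by (simp add: mem_lens_iff p_def cmod_power2 power_divide)
  qed
  have u: "odd_koebe (p 0) = 2 / 3" "odd_koebe (p (3 / 10)) = Complex (275 / 663) (335 / 663)"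
    by (simp_all add: odd_koebe_def p_def complex_eq_iff Re_divide Im_divide power2_eq_square)
  have "\<exists>t\<ge>0. t \<le> 3 / 10 \<and> Re (shear (p t)) = 0"
  proof (rule IVT2')
    show "Re (shear (p (3 / 10))) \<le> 0" "0 \<le> Re (shear (p 0))"
      by (simp_all add: shear_def u power3_eq_cube)
    have "shear holomorphic_on unit_disk"
      using deriv_shear unit_disk_neq(3) unfolding holomorphic_on_open[OF open_ball] by blast
    then have c: "continuous_on unit_disk shear" by (rule holomorphic_on_imp_continuous_on)
    have "p t \<in> unit_disk" if "t \<in> {0..3/10}" for t
    proof -
      have "(cmod (p t))\<^sup>2 < 1" using lens[of t] that by (simp add: mem_lens_iff)
      then show ?thesis by (simp add: power_less_one_iff)
    qed
    then have "p ` {0..3/10} \<subseteq> unit_disk" by blast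
    moreover have "continuous_on {0..3/10} p"
      unfolding p_def Complex_eq by (intro continuous_intros)
    ultimately have "continuous_on {0..3/10} (\<lambda>t. shear (p t))"
      by (intro continuous_on_compose2[OF c])
    then show "continuous_on {0..3/10} (\<lambda>t. Re (shear (p t)))"
      by (rule continuous_on_Re)
  qed simp
  then obtain t where "0 \<le> t" "t \<le> 3 / 10" "Re (shear (p t)) = 0" by blast
  with lens[of t] show ?thesis
    by (intro bexI[of _ "p t"]) (auto simp: Re_counterexample p_def)
qed

theorem theorem5:
  shows "\<exists>f \<in> T_H_O. \<not> inj_on f lens"
proof
  show "counterexample \<in> T_H_O" by (rule counterexample_in_T_H_O)
  show "\<not> inj_on counterexample lens"
  proof
    assume inj: "inj_on counterexample lens"
    obtain z where z: "z \<in> lens" "Re z \<noteq> 0" "Re (counterexample z) = 0"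
      using exists_lens_imaginary_value by blast
    have "counterexample (- cnj z) = counterexample z"
      using z(3) by (simp add: counterexample_uminus_cnj complex_eq_iff)
    moreover have "- cnj z \<in> lens" using z(1) by (simp add: mem_lens_iff)
    ultimately have "- cnj z = z" using inj z(1) by (auto dest: inj_onD)
    then show False using z(2) by (simp add: complex_eq_iff)
  qed
qed

end
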